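(* Let $k\ge 3$ and let $G_k$ be a complete $k$-partite graph. Then $G_k$ is strictly $k$-colorable if and only if $G_k$ contains at least one of $K_{3*k}$, $K_{2,4,6*(k-2)}$, or $K_{2,5*(k-1)}$ as a subgraph.
   Context: Graphs are finite and simple. An integer partition $\lambda$ of a positive integer $k$ is a multiset of positive integers summing to $k$; the notation $a*b$ denotes $b$ copies of $a$, so e.g. $\{1*(k-2),2\}$ is the partition consisting of $k-2$ ones and one $2$. Similarly $K_{a*b}$ denotes the complete $b$-partite graph with all parts of size $a$, and e.g. $K_{2,4,6*(k-2)}$ is the complete $k$-partite graph with parts of sizes $2,4$ and $k-2$ parts of size $6$, and $K_{2,5*(k-1)}$ has one part of size $2$ and $k-1$ parts of size $5$. A $k$-assignment $L$ of $G$ assigns to each vertex $v$ a set $L(v)$ of $k$ colors; $G$ is $L$-colorable if there is a proper coloring with each vertex $v$ receiving a color from $L(v)$. For an integer partition $\lambda=\{k_1,\dots,k_t\}$ of $k$, a $\lambda$-assignment of $G$ is a $k$-assignment $L$ such that the set $\bigcup_{v}L(v)$ can be partitioned into sets $C_1,\dots,C_t$ with $|L(v)\cap C_i|=k_i$ for every vertex $v$ and every $i$. $G$ is $\lambda$-choosable if $G$ is $L$-colorable for every $\lambda$-assignment $L$. (It is known that $G$ is $\{1*k\}$-choosable iff $G$ is $k$-colorable.) A graph $G$ is strictly $k$-colorable if $\{1*k\}$ is the only integer partition $\lambda$ of $k$ for which $G$ is $\lambda$-choosable, i.e. $G$ is $\{1*k\}$-choosable and $G$ is not $\lambda$-choosable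 for any other partition $\lambda$ of $k$. *)

theory Defs
  imports
    "Graph_Theory.Graph_Theory"
    "HOL-Library.Multiset"
    "HOL-Library.Disjoint_Sets"
begin

text \<open>
  A finite simple graph is a \<open>pair_graph\<close>: a finite, loop-free digraph without parallel arcs whose
  arc relation is symmetric, an edge \<open>uv\<close> being represented by the two arcs \<open>(u, v)\<close> and \<open>(v, u)\<close>.
\<close>

text \<open>
  \<open>G\<close> is a copy of the complete multipartite graph whose part sizes form the multiset \<open>ns\<close>; the
  parts are nonempty by \<open>partition_on\<close>. Like the predicates for complete and complete bipartite
  digraphs in \<open>Graph_Theory.Kuratowski\<close>, this describes \<open>G\<close> only up to isomorphism.
\<close>

definition complete_multipartite :: "nat multiset \<Rightarrow> 'a pair_pre_digraph \<Rightarrow> bool" where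
  "complete_multipartite ns G \<longleftrightarrow> pair_graph G \<and>
     (\<exists>P. partition_on (pverts G) P \<and> image_mset card (mset_set P) = ns \<and>
        parcs G = {(u, v). u \<in> pverts G \<and> v \<in> pverts G \<and> \<not> (\<exists>A\<in>P. u \<in> A \<and> v \<in> A)})"

definition complete_partite :: "nat \<Rightarrow> 'a pair_pre_digraph \<Rightarrow> bool" where
  "complete_partite k G \<longleftrightarrow> (\<exists>ns. size ns = k \<and> complete_multipartite ns G)"

definition contains_complete_multipartite :: "'a pair_pre_digraph \<Rightarrow> nat multiset \<Rightarrow> bool" where
  "contains_complete_multipartite G ns \<longleftrightarrow>
     (\<exists>H :: 'a pair_pre_digraph. subgraph (with_proj H) (with_proj G) \<and> complete_multipartite ns H)"

definition integer_partition :: "nat \<Rightarrow> nat multiset \<Rightarrow> bool" where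
  "integer_partition k lam \<longleftrightarrow> (\<forall>i\<in>#lam. 0 < i) \<and> sum_mset lam = k"

definition k_assignment :: "'a pair_pre_digraph \<Rightarrow> nat \<Rightarrow> ('a \<Rightarrow> 'c set) \<Rightarrow> bool" where
  "k_assignment G k L \<longleftrightarrow> (\<forall>v\<in>pverts G. finite (L v) \<and> card (L v) = k)"

definition list_colorable :: "'a pair_pre_digraph \<Rightarrow> ('a \<Rightarrow> 'c set) \<Rightarrow> bool" where
  "list_colorable G L \<longleftrightarrow>
     (\<exists>c. (\<forall>v\<in>pverts G. c v \<in> L v) \<and> (\<forall>(u, v)\<in>parcs G. c u \<noteq> c v))"

text \<open>The list \<open>ks\<close> enumerates the parts of \<open>lam\<close>, so that the color classes can be indexed.\<close>

definition partition_assignment ::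
  "'a pair_pre_digraph \<Rightarrow> nat multiset \<Rightarrow> ('a \<Rightarrow> 'c set) \<Rightarrow> bool" where
  "partition_assignment G lam L \<longleftrightarrow> k_assignment G (sum_mset lam) L \<and>
     (\<exists>ks C. mset ks = lam \<and>
        disjoint_family_on C {..<length ks} \<and>
        (\<Union>i<length ks. C i) = (\<Union>v\<in>pverts G. L v) \<and>
        (\<forall>v\<in>pverts G. \<forall>i<length ks. card (L v \<inter> C i) = ks ! i))"

text \<open>
  Colors are natural numbers. This is no restriction: the lists of a finite graph involve only
  finitely many colors.
\<close>

definition choosable :: "'a pair_pre_digraph \<Rightarrow> nat multiset \<Rightarrow> bool" where
  "choosable G lam \<longleftrightarrow>
     (\<forall>L :: 'a \<Rightarrow> nat set. partition_assignment G lam L \<longrightarrow> list_colorable G L)"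

definition strictly_colorable :: "nat \<Rightarrow> 'a pair_pre_digraph \<Rightarrow> bool" where
  "strictly_colorable k G \<longleftrightarrow>
     (\<forall>lam. integer_partition k lam \<longrightarrow> (choosable G lam \<longleftrightarrow> lam = replicate_mset k 1))"

end

theory Submission
  imports Defs
begin

text \<open>
  If \<open>\<lambda>\<close> has a part at least \<open>2\<close>, its worst assignments give every vertex the same \<open>k - 2\<close> colors
  together with a pair \<open>S v\<close> of colors. Each common color serves only one of the \<open>k\<close> parts of \<open>G\<close>,
  so such an assignment admits a coloring iff the complete bipartite graph on some two of the parts
  is \<open>S\<close>-colorable. Regarding the pairs \<open>S v\<close>, \<open>v \<in> A\<close>, as the edges of a graph on the colors, the
  parts \<open>A\<close> and \<open>B\<close> are \<open>S\<close>-colorable iff their graphs have disjoint vertex covers. Thus \<open>G\<close> is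
  strictly \<open>k\<close>-colorable iff there are \<open>k\<close> graphs, with no more edges than the corresponding part
  has vertices, no two of which have disjoint vertex covers. Such graphs have at least two edges
  each. If one of them has just two, these are disjoint edges \<open>ab\<close>, \<open>cd\<close>, and all others contain
  the four-cycle \<open>acbd\<close>; if one of these others is exactly that cycle, then all the remaining ones
  contain the complete graph on \<open>{a, b, c, d}\<close>.
\<close>

section \<open>Graphs without disjoint vertex covers\<close>

text \<open>One set \<open>X\<close> encodes both covers: a cover of \<open>F\<close> disjoint from
  \<open>X\<close> can be enlarged to the complement of \<open>X\<close>.\<close>

definition no_disjoint_covers :: "'c set set \<Rightarrow> 'c set set \<Rightarrow> bool" where
  "no_disjoint_covers E F \<longleftrightarrow> \<not> (\<exists>X. (\<forall>e\<in>E. e \<inter> X \<noteq> {}) \<and> (\<forall>f\<in>F. f - X \<noteq> {}))"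

lemma no_disjoint_covers_sym:
  assumes "no_disjoint_covers E F"
  shows "no_disjoint_covers F E"
proof -
  have False if "\<forall>e\<in>F. e \<inter> X \<noteq> {}" "\<forall>f\<in>E. f - X \<noteq> {}" for X
  proof -
    have "\<forall>e\<in>E. e \<inter> - X \<noteq> {}" "\<forall>f\<in>F. f - - X \<noteq> {}"
      using that by (auto simp: Diff_eq)
    then show False
      using assms unfolding no_disjoint_covers_def by blast
  qed
  then show ?thesis
    unfolding no_disjoint_covers_def by blast
qed

section \<open>Edges that one graph forces in another\<close>

text \<open>The set \<open>X = {a, b}\<close> covers \<open>E\<close>, so its complement misses an
  edge of \<open>F\<close>; that edge lies inside \<open>{a, b}\<close> and has two elements. The
  case \<open>a = b\<close> is allowed and serves to exclude covers by a single vertex.\<close>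

lemma no_disjoint_covers_edge:
  assumes "no_disjoint_covers E F" "\<forall>f\<in>F. card f = 2" "\<forall>e\<in>E. e \<inter> {a, b} \<noteq> {}"
  shows "{a, b} \<in> F"
proof -
  have "\<not> (\<forall>f\<in>F. f - {a, b} \<noteq> {})"
    using assms(1,3) unfolding no_disjoint_covers_def by metis
  then obtain f where f: "f \<in> F" "f \<subseteq> {a, b}"
    by (auto simp: Diff_eq_empty_iff)
  moreover have "card {a, b} \<le> card f"
    using f(1) assms(2) by (simp add: card_insert_if)
  ultimately have "f = {a, b}"
    by (intro card_seteq) auto
  with f(1) show ?thesis by simp
qed

text \<open>A single vertex covering \<open>E\<close> would force the singleton
  \<open>{a, a}\<close> into \<open>F\<close>, whose members have two elements.\<close>

lemma no_disjoint_covers_no_vertex: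
  assumes "no_disjoint_covers E F" "\<forall>f\<in>F. card f = 2"
  shows "\<exists>e\<in>E. a \<notin> e"
proof (rule ccontr)
  assume "\<not> (\<exists>e\<in>E. a \<notin> e)"
  then have "{a, a} \<in> F"
    by (intro no_disjoint_covers_edge[OF assms]) auto
  then show False
    using assms(2) by fastforce
qed

lemma no_disjoint_covers_card_ge_2:
  assumes "no_disjoint_covers E F" "\<forall>f\<in>F. card f = 2" "finite E" "\<forall>e\<in>E. card e = 2"
  shows "2 \<le> card E"
proof (rule ccontr)
  assume "\<not> 2 \<le> card E"
  then have "card E = 0 \<or> card E = 1" by linarith
  then show False
  proof
    assume "card E = 0"
    with assms(3) no_disjoint_covers_no_vertex[OF assms(1,2)] show False by auto
  next
    assume "card E = 1"
    then obtain e where e: "E = {e}" by (auto simp: card_1_singleton_iff)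
    with assms(4) obtain a where "a \<in> e" by fastforce
    with e no_disjoint_covers_no_vertex[OF assms(1,2), of a] show False by auto
  qed
qed

text \<open>A vertex shared by the two edges would cover \<open>E\<close> on its own, so the edges
  form a matching.\<close>

lemma no_disjoint_covers_card_2:
  assumes "no_disjoint_covers E F" "\<forall>f\<in>F. card f = 2" "\<forall>e\<in>E. card e = 2" "card E = 2"
  obtains a b c d where "distinct [a, b, c, d]" "E = {{a, b}, {c, d}}"
proof -
  obtain e f where ef: "E = {e, f}" "e \<noteq> f"
    using assms(4) by (auto simp: card_2_iff)
  obtain a b where ab: "e = {a, b}" "a \<noteq> b"
    using assms(3) ef by (auto simp: card_2_iff)
  obtain c d where cd: "f = {c, d}" "c \<noteq> d"
    using assms(3) ef by (auto simp: card_2_iff)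
  have "x \<notin> e \<or> x \<notin> f" for x
    using no_disjoint_covers_no_vertex[OF assms(1,2), of x] ef by auto
  then have "distinct [a, b, c, d]"
    using ab cd by auto
  with that ef ab cd show thesis by blast
qed

text \<open>Each of the four pairs takes one end from each matching edge, hence covers the matching
  and is forced into \<open>F\<close>.\<close>

lemma matching_forces_four_cycle:
  assumes "no_disjoint_covers {{a, b}, {c, d}} F" "\<forall>f\<in>F. card f = 2"
  shows "{{a, c}, {a, d}, {b, c}, {b, d}} \<subseteq> F"
  by (simp add: no_disjoint_covers_edge[OF assms])

text \<open>The cycle is bipartite with sides \<open>{a, b}\<close> and \<open>{c, d}\<close>, and
  each side covers it.\<close>

lemma four_cycle_forces_diagonals:
  assumes "no_disjoint_covers {{a, c}, {a, d}, {b, c}, {b, d}} F" "\<forall>f\<in>F. card f = 2"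
  shows "{{a, b}, {c, d}} \<subseteq> F"
  by (simp add: no_disjoint_covers_edge[OF assms])

lemma card_four_cycle:
  assumes "distinct [a, b, c, d]"
  shows "card {{a, c}, {a, d}, {b, c}, {b, d}} = 4"
  using assms by (simp add: card_insert_if doubleton_eq_iff)

lemma card_complete_4:
  assumes "distinct [a, b, c, d]"
  shows "card ({{a, c}, {a, d}, {b, c}, {b, d}} \<union> {{a, b}, {c, d}}) = 6"
  using assms by (auto simp: card_insert_if doubleton_eq_iff)

text \<open>The three outcomes correspond to the three subgraphs of the theorem, with
  \<open>card (E A)\<close> as a lower bound for the size of the part \<open>A\<close>.\<close>

lemma pairwise_no_disjoint_covers_cards:
  assumes P: "2 \<le> card P"
    and E: "\<And>A. A \<in> P \<Longrightarrow> finite (E A)" "\<And>A. A \<in> P \<Longrightarrow> \<forall>e\<in>E A. card e = 2"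
    and cov: "\<And>A B. A \<in> P \<Longrightarrow> B \<in> P \<Longrightarrow> A \<noteq> B \<Longrightarrow> no_disjoint_covers (E A) (E B)"
  obtains
    (three) "\<And>A. A \<in> P \<Longrightarrow> 3 \<le> card (E A)"
  | (two_five) A where "A \<in> P" "2 \<le> card (E A)" "\<And>B. B \<in> P \<Longrightarrow> B \<noteq> A \<Longrightarrow> 5 \<le> card (E B)"
  | (two_four_six) A B where "A \<in> P" "B \<in> P" "A \<noteq> B" "2 \<le> card (E A)" "4 \<le> card (E B)"
      "\<And>C. C \<in> P \<Longrightarrow> C \<noteq> A \<Longrightarrow> C \<noteq> B \<Longrightarrow> 6 \<le> card (E C)"
proof (cases "\<forall>A\<in>P. 3 \<le> card (E A)")
  case True
  with three show thesis by blast
next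
  case False
  then obtain A where A: "A \<in> P" "card (E A) < 3" by force
  \<comment> \<open>Conditions hold only between distinct parts, so a second part is needed to
    conclude anything about \<open>E A\<close>.\<close>
  have "\<not> P \<subseteq> {A}"
    using P card_mono[of "{A}" P] by auto
  then obtain A' where A': "A' \<in> P" "A' \<noteq> A" by blast
  have cA: "no_disjoint_covers (E A) (E A')"
    using cov A A' by metis
  have "2 \<le> card (E A)"
    using no_disjoint_covers_card_ge_2[OF cA] E A A' by blast
  with A have A2: "card (E A) = 2" by simp
  obtain a b c d where abcd: "distinct [a, b, c, d]" "E A = {{a, b}, {c, d}}"
    using no_disjoint_covers_card_2[OF cA _ _ A2] E A A' by metis
  let ?C = "{{a, c}, {a, d}, {b, c}, {b, d}}"
  have C: "?C \<subseteq> E B" if "B \<in> P" "B \<noteq> A" for B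
    using matching_forces_four_cycle[of a b c d "E B"] cov[of A B] abcd(2) E(2) A(1) that
    by metis
  have four: "4 \<le> card (E B)" if "B \<in> P" "B \<noteq> A" for B
    unfolding card_four_cycle[OF abcd(1), symmetric] using that by (intro card_mono E(1) C)
  show thesis
  proof (cases "\<forall>B\<in>P - {A}. 5 \<le> card (E B)")
    case True
    with two_five A(1) A2 show thesis by simp
  next
    case False
    then obtain B where B: "B \<in> P" "B \<noteq> A" "card (E B) < 5" by force
    with four have "card (E B) = 4" by force
    with B C E(1) card_four_cycle[OF abcd(1)] have EB: "?C = E B"
      by (intro card_seteq) auto
    have "6 \<le> card (E D)" if D: "D \<in> P" "D \<noteq> A" "D \<noteq> B" for D
    proof -
      have "no_disjoint_covers ?C (E D)"
        unfolding EB using cov[OF B(1) D(1)] D(3) by blast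
      then have "{{a, b}, {c, d}} \<subseteq> E D"
        using E(2)[OF D(1)] by (rule four_cycle_forces_diagonals)
      then have "?C \<union> {{a, b}, {c, d}} \<subseteq> E D"
        using C[OF D(1,2)] by (rule Un_least[rotated])
      then show ?thesis
        unfolding card_complete_4[OF abcd(1), symmetric] by (intro card_mono E(1) D(1))
    qed
    then show thesis
      using A(1) A2 B(1,2) four by (intro two_four_six[of A B]) auto
  qed
qed

section \<open>Extremal graphs on four colors\<close>

text \<open>In order: a matching, a triangle, the four-cycle through \<open>0, 2, 1, 3\<close>, the
  complete graph on four vertices without \<open>{2, 3}\<close>, and the complete graph
  itself.\<close>

definition witness_edges :: "nat \<Rightarrow> nat set set" where
  "witness_edges n =
     (if n = 2 then {{0, 1}, {2, 3}}
      else if n = 3 then {{0, 1}, {0, 2}, {1, 2}}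
      else if n = 4 then {{0, 2}, {0, 3}, {1, 2}, {1, 3}}
      else if n = 5 then {{0, 1}, {0, 2}, {0, 3}, {1, 2}, {1, 3}}
      else {{0, 1}, {2, 3}, {0, 2}, {0, 3}, {1, 2}, {1, 3}})"

lemma card_witness_edges:
  assumes "n \<in> {2..6}"
  shows "card (witness_edges n) = n"
proof -
  have "n = 2 \<or> n = 3 \<or> n = 4 \<or> n = 5 \<or> n = 6"
    using assms by auto
  then show ?thesis
    by (auto simp: witness_edges_def card_insert_if doubleton_eq_iff)
qed

lemma finite_witness_edges: "finite (witness_edges n)"
  by (simp add: witness_edges_def)

text \<open>The bound leaves the colors from 4 on free to be shared by all lists.\<close>

lemma witness_edges_pairs:
  assumes "e \<in> witness_edges n"
  shows "card e = 2" "e \<subseteq> {..<4}"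
  using assms by (auto simp: witness_edges_def split: if_splits)

text \<open>For \<open>m = n\<close> the claim says that the graph is not bipartite, and each of the
  graphs for 3, 5 and 6 contains a triangle. The matching and the four-cycle are bipartite, so
  \<open>(2, 2)\<close> and \<open>(4, 4)\<close> are absent. In the other pairs, every cover of the
  first graph contains an edge of the second.\<close>

lemma no_disjoint_covers_witness_edges:
  assumes "(m, n) \<in> {(3, 3), (2, 4), (2, 5), (2, 6), (4, 6), (5, 5), (6, 6)}"
  shows "no_disjoint_covers (witness_edges m) (witness_edges n)"
  using assms by (auto simp: no_disjoint_covers_def witness_edges_def)

section \<open>Complete multipartite graphs\<close>

text \<open>This names the partition that \<open>complete_multipartite\<close> hides behind a
  quantifier, so that colors can be distributed part by part.\<close>

definition multipartition :: "'a pair_pre_digraph \<Rightarrow> 'a set set \<Rightarrow> bool" where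
  "multipartition G P \<longleftrightarrow> partition_on (pverts G) P \<and>
     parcs G = {(u, v). u \<in> pverts G \<and> v \<in> pverts G \<and> \<not> (\<exists>A\<in>P. u \<in> A \<and> v \<in> A)}"

lemma complete_multipartite_iff:
  "complete_multipartite ns G \<longleftrightarrow>
     pair_graph G \<and> (\<exists>P. multipartition G P \<and> image_mset card (mset_set P) = ns)"
  unfolding complete_multipartite_def multipartition_def by auto

lemma multipartition_finite:
  assumes "pair_graph G" "multipartition G P"
  shows "finite (pverts G)" "finite P" "\<And>A. A \<in> P \<Longrightarrow> finite A"
proof -
  interpret pair_graph G by fact
  have P: "partition_on (pverts G) P"
    using assms(2) by (simp add: multipartition_def)
  show V: "finite (pverts G)"
    by (rule pair_finite_verts)
  show "finite P"
    using V P by (rule finite_elements)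
  show "finite A" if "A \<in> P" for A
    using V P that unfolding partition_on_def by (auto intro: finite_subset)
qed

lemma multipartition_pair_graph:
  assumes "finite (pverts G)" "multipartition G P"
  shows "pair_graph G"
proof -
  have arcs: "parcs G = {(u, v). u \<in> pverts G \<and> v \<in> pverts G \<and> \<not> (\<exists>A\<in>P. u \<in> A \<and> v \<in> A)}"
    and P: "partition_on (pverts G) P"
    using assms(2) by (auto simp: multipartition_def)
  have "finite (parcs G)"
    by (rule finite_subset[of _ "pverts G \<times> pverts G"]) (use assms(1) arcs in auto)
  moreover have "sym (parcs G)"
    unfolding arcs sym_def by blast
  \<comment> \<open>There are no loops because every vertex shares a part with itself.\<close>
  moreover have "fst e \<noteq> snd e" if "e \<in> parcs G" for e
  proof
    assume "fst e = snd e"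
    with that have "fst e \<in> pverts G" "\<not> (\<exists>A\<in>P. fst e \<in> A)"
      by (simp_all add: arcs case_prod_unfold)
    with partition_onD1[OF P] show False by simp
  qed
  ultimately show ?thesis
    using assms(1) arcs by unfold_locales (auto simp: symmetric_def)
qed

lemma part_eqI:
  assumes "multipartition G P" "A \<in> P" "B \<in> P" "v \<in> A" "v \<in> B"
  shows "A = B"
  using assms unfolding multipartition_def partition_on_def disjoint_def by blast

section \<open>Colorings as disjoint palettes\<close>

text \<open>Vertices in different parts are adjacent, so the color sets used on the parts are
  disjoint. Conversely, vertices in one part are nonadjacent, so each may take any color of its list
  from the palette of its part.\<close>

lemma list_colorable_iff_palettes:
  assumes G: "multipartition G P"
  shows "list_colorable G L \<longleftrightarrow>
    (\<exists>D. disjoint_family_on D P \<and> (\<forall>A\<in>P. \<forall>v\<in>A. L v \<inter> D A \<noteq> {}))"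
proof
  have V: "pverts G = \<Union>P"
    using G by (simp add: multipartition_def partition_on_def)
  have arcs: "(u, v) \<in> parcs G \<longleftrightarrow>
      u \<in> pverts G \<and> v \<in> pverts G \<and> \<not> (\<exists>A\<in>P. u \<in> A \<and> v \<in> A)" for u v
    using G by (simp add: multipartition_def)
  {
    assume "list_colorable G L"
    then obtain c where c: "\<forall>v\<in>pverts G. c v \<in> L v" "\<forall>(u, v)\<in>parcs G. c u \<noteq> c v"
      unfolding list_colorable_def by blast
    have "c u \<noteq> c v" if "A \<in> P" "B \<in> P" "A \<noteq> B" "u \<in> A" "v \<in> B" for A B u v
    proof -
      have "(u, v) \<in> parcs G"
        unfolding arcs V using that part_eqI[OF G] by blast
      with c(2) show ?thesis by auto
    qed
    then have "disjoint_family_on (\<lambda>A. c ` A) P"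
      unfolding disjoint_family_on_def by fast
    moreover have "\<forall>A\<in>P. \<forall>v\<in>A. L v \<inter> c ` A \<noteq> {}"
      using c(1) V by blast
    ultimately show "\<exists>D. disjoint_family_on D P \<and> (\<forall>A\<in>P. \<forall>v\<in>A. L v \<inter> D A \<noteq> {})"
      by (intro exI[of _ "\<lambda>A. c ` A"]) simp
  next
    assume "\<exists>D. disjoint_family_on D P \<and> (\<forall>A\<in>P. \<forall>v\<in>A. L v \<inter> D A \<noteq> {})"
    then obtain D where D: "disjoint_family_on D P" "\<forall>A\<in>P. \<forall>v\<in>A. L v \<inter> D A \<noteq> {}"
      by blast
    have "\<exists>x. x \<in> L v \<and> (\<exists>A\<in>P. v \<in> A \<and> x \<in> D A)" if v: "v \<in> pverts G" for v
    proof -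
      obtain A where A: "A \<in> P" "v \<in> A"
        using v V by auto
      with D(2) obtain x where "x \<in> L v \<inter> D A" by blast
      with A show ?thesis by auto
    qed
    then obtain c where c: "\<And>v. v \<in> pverts G \<Longrightarrow> c v \<in> L v \<and> (\<exists>A\<in>P. v \<in> A \<and> c v \<in> D A)"
      by metis
    have "c u \<noteq> c v" if "(u, v) \<in> parcs G" for u v
    proof -
      have uv: "u \<in> pverts G" "v \<in> pverts G" "\<not> (\<exists>A\<in>P. u \<in> A \<and> v \<in> A)"
        using that arcs by auto
      then obtain A B where "A \<in> P" "u \<in> A" "c u \<in> D A" "B \<in> P" "v \<in> B" "c v \<in> D B"
        using c by meson
      with uv(3) D(1) show ?thesis
        unfolding disjoint_family_on_def by (metis disjoint_iff)
    qed
    with c show "list_colorable G L"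
      unfolding list_colorable_def by blast
  }
qed

lemma list_colorable_subgraph:
  assumes "subgraph (with_proj H) (with_proj G)" "list_colorable G L"
  shows "list_colorable H L"
proof -
  have sub: "pverts H \<subseteq> pverts G" "parcs H \<subseteq> parcs G"
    using assms(1) by (simp_all add: subgraph_def)
  obtain c where "\<forall>v\<in>pverts G. c v \<in> L v" "\<forall>(u, v)\<in>parcs G. c u \<noteq> c v"
    using assms(2) unfolding list_colorable_def by blast
  with sub show ?thesis
    unfolding list_colorable_def by (intro exI[of _ c]) blast
qed

text \<open>Each part \<open>A\<close> is trimmed to a subset \<open>g A\<close> of size
  \<open>f A\<close>; the subgraph induced on the union is again complete multipartite.\<close>

lemma contains_complete_multipartiteI:
  assumes G: "pair_graph G" "multipartition G P"
    and f: "\<And>A. A \<in> P \<Longrightarrow> 0 < f A \<and> f A \<le> card A"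
  shows "contains_complete_multipartite G (image_mset f (mset_set P))"
proof -
  have V: "pverts G = \<Union>P"
    using G(2) by (simp add: multipartition_def partition_on_def)
  have "\<forall>A\<in>P. \<exists>B. B \<subseteq> A \<and> card B = f A"
    using f by (meson obtain_subset_with_card_n)
  then obtain g where g: "\<And>A. A \<in> P \<Longrightarrow> g A \<subseteq> A \<and> card (g A) = f A"
    by metis
  have ne: "g A \<noteq> {}" if "A \<in> P" for A
    using g[OF that] f[OF that] by auto
  have g_eq: "A = B" if "A \<in> P" "B \<in> P" "v \<in> g A" "v \<in> g B" for A B v
    using part_eqI[OF G(2), of A B v] g that by blast
  \<comment> \<open>Injectivity makes the parts of \<open>H\<close> correspond one to one to those
    of \<open>G\<close>, so that multiplicities of sizes are kept.\<close>
  have inj: "inj_on g P"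
    using g_eq ne by (metis inj_onI ex_in_conv)
  define W where "W = \<Union>(g ` P)"
  define H where "H = \<lparr>pverts = W,
    parcs = {(u, v). u \<in> W \<and> v \<in> W \<and> \<not> (\<exists>A\<in>g ` P. u \<in> A \<and> v \<in> A)}\<rparr>"
  have W: "W \<subseteq> pverts G"
    unfolding W_def V using g by blast
  have "partition_on W (g ` P)"
    unfolding partition_on_def W_def disjoint_def using ne g_eq by blast
  then have multi: "multipartition H (g ` P)"
    by (simp add: multipartition_def H_def)
  have "finite (pverts H)"
    using W multipartition_finite(1)[OF G] by (simp add: H_def finite_subset)
  then have H: "pair_graph H"
    using multi by (rule multipartition_pair_graph)
  have "image_mset card (mset_set (g ` P)) = image_mset (\<lambda>A. card (g A)) (mset_set P)"
    by (simp add: image_mset_mset_set[OF inj, symmetric] multiset.map_comp comp_def)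
  also have "\<dots> = image_mset f (mset_set P)"
    using g multipartition_finite(2)[OF G] by (intro image_mset_cong) simp
  finally have "complete_multipartite (image_mset f (mset_set P)) H"
    unfolding complete_multipartite_iff using H multi by blast
  moreover have "subgraph (with_proj H) (with_proj G)"
  proof -
    have "parcs H \<subseteq> parcs G"
    proof
      fix e assume "e \<in> parcs H"
      then obtain u v where e: "e = (u, v)" "u \<in> W" "v \<in> W"
        and sep: "\<not> (\<exists>A\<in>P. u \<in> g A \<and> v \<in> g A)"
        by (auto simp: H_def)
      have "\<not> (\<exists>A\<in>P. u \<in> A \<and> v \<in> A)"
      proof
        assume "\<exists>A\<in>P. u \<in> A \<and> v \<in> A"
        then obtain A where A: "A \<in> P" "u \<in> A" "v \<in> A" by blast
        have "w \<in> g A" if "w \<in> W" "w \<in> A" for w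
          using that A(1) g part_eqI[OF G(2)] unfolding W_def by blast
        with e A sep show False by blast
      qed
      with e W G(2) show "e \<in> parcs G"
        by (auto simp: multipartition_def)
    qed
    moreover have "pair_wf_digraph G" "pair_wf_digraph H"
      using G(1) H by (simp_all add: pair_graph_def pair_digraph_def pair_fin_digraph_def)
    ultimately show ?thesis
      using W by (simp add: subgraph_def wf_digraph_wp_iff compatible_def H_def)
  qed
  ultimately show ?thesis
    unfolding contains_complete_multipartite_def by blast
qed

section \<open>Strict colorability\<close>

text \<open>The \<open>k\<close> color classes are matched with the \<open>k\<close> parts; every
  list has a color in each class, so the classes serve as palettes.\<close>

lemma choosable_replicate_1:
  assumes G: "pair_graph G" "multipartition G P" and k: "card P = k"
  shows "choosable G (replicate_mset k 1)"
  unfolding choosable_def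
proof (intro allI impI)
  fix L :: "'a \<Rightarrow> nat set"
  assume "partition_assignment G (replicate_mset k 1) L"
  then obtain ks C where ks: "mset ks = replicate_mset k 1"
    and C: "disjoint_family_on C {..<length ks}"
      "\<forall>v\<in>pverts G. \<forall>i<length ks. card (L v \<inter> C i) = ks ! i"
    unfolding partition_assignment_def by blast
  have len: "length ks = k"
    using ks by (metis size_mset size_replicate_mset)
  have nth: "ks ! i = 1" if "i < length ks" for i
    using nth_mem_mset[OF that] ks by (auto split: if_splits)
  obtain f where f: "bij_betw f P {..<k}"
    using multipartition_finite(2)[OF G] k by (metis atLeast0LessThan ex_bij_betw_finite_nat)
  have "disjoint_family_on (\<lambda>A. C (f A)) P"
    using C(1) f len unfolding disjoint_family_on_def bij_betw_def inj_on_def by blast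
  moreover have "L v \<inter> C (f A) \<noteq> {}" if "A \<in> P" "v \<in> A" for A v
  proof -
    have "v \<in> pverts G"
      using G(2) that by (auto simp: multipartition_def partition_on_def)
    moreover have "f A < length ks"
      using f that(1) len by (auto simp: bij_betw_def)
    ultimately have "card (L v \<inter> C (f A)) = 1"
      using C(2) nth by metis
    then show ?thesis by auto
  qed
  ultimately show "list_colorable G L"
    unfolding list_colorable_iff_palettes[OF G(2)] by (intro exI[of _ "\<lambda>A. C (f A)"]) simp
qed

section \<open>From an uncolorable assignment to pairs of colors\<close>

text \<open>The pair \<open>S v\<close> is what \<open>L v\<close> has in the class of part size 2.
  If two parts \<open>A\<close> and \<open>B\<close> had disjoint covers, that class could be split
  between them, and the remaining \<open>k - 2\<close> classes would serve the remaining
  \<open>k - 2\<close> parts, so that \<open>G\<close> could be colored.\<close>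

lemma not_choosable_imp_pairs:
  assumes G: "pair_graph G" "multipartition G P" and k: "card P = k"
    and not: "\<not> choosable G ({#2#} + replicate_mset (k - 2) 1)" and "2 \<le> k"
  obtains S :: "'a \<Rightarrow> nat set" where "\<And>v. v \<in> pverts G \<Longrightarrow> card (S v) = 2"
    "\<And>A B. A \<in> P \<Longrightarrow> B \<in> P \<Longrightarrow> A \<noteq> B \<Longrightarrow> no_disjoint_covers (S ` A) (S ` B)"
proof -
  let ?lam = "{#2#} + replicate_mset (k - 2) 1 :: nat multiset"
  obtain L :: "'a \<Rightarrow> nat set" where L: "partition_assignment G ?lam L"
    and ncol: "\<not> list_colorable G L"
    using not unfolding choosable_def by blast
  from L obtain ks C where ks: "mset ks = ?lam"
    and C: "disjoint_family_on C {..<length ks}"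
      "\<forall>v\<in>pverts G. \<forall>i<length ks. card (L v \<inter> C i) = ks ! i"
    unfolding partition_assignment_def by blast
  have len: "length ks = k - 1"
    using arg_cong[OF ks, of size] \<open>2 \<le> k\<close> by simp
  have pos: "0 < ks ! i" if "i < length ks" for i
    using nth_mem_mset[OF that] ks by (auto split: if_splits)
  have "2 \<in># mset ks"
    using ks by simp
  then obtain j where j: "j < length ks" "ks ! j = 2"
    by (metis in_set_conv_nth set_mset_mset)
  show thesis
  \<comment> \<open>The witness is \<open>S v = L v \<inter> C j\<close>.\<close>
  proof (rule that)
    show "card (L v \<inter> C j) = 2" if "v \<in> pverts G" for v
      using C(2) j that by metis
  next
    fix A B assume AB: "A \<in> P" "B \<in> P" "A \<noteq> B"
    show "no_disjoint_covers ((\<lambda>v. L v \<inter> C j) ` A) ((\<lambda>v. L v \<inter> C j) ` B)"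
      unfolding no_disjoint_covers_def
    proof
      assume "\<exists>X. (\<forall>e\<in>(\<lambda>v. L v \<inter> C j) ` A. e \<inter> X \<noteq> {}) \<and> (\<forall>f\<in>(\<lambda>v. L v \<inter> C j) ` B. f - X \<noteq> {})"
      then obtain X where X: "\<And>v. v \<in> A \<Longrightarrow> L v \<inter> C j \<inter> X \<noteq> {}"
        "\<And>v. v \<in> B \<Longrightarrow> L v \<inter> C j - X \<noteq> {}"
        by auto
      have fin: "finite P"
        by (rule multipartition_finite(2)[OF G])
      have "card (P - {A, B}) = k - 2"
        using AB k fin by (simp add: card_Diff_subset)
      moreover have "card ({..<length ks} - {j}) = k - 2"
        using j(1) len by simp
      ultimately obtain f where f: "bij_betw f (P - {A, B}) ({..<length ks} - {j})"
        using fin finite_same_card_bij by (metis finite_Diff finite_lessThan)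
      have f_less: "f D < length ks" "f D \<noteq> j" if "D \<in> P" "D \<noteq> A" "D \<noteq> B" for D
        using bij_betwE[OF f] that by auto
      have f_neq: "f D \<noteq> f D'" if "D \<in> P - {A, B}" "D' \<in> P - {A, B}" "D \<noteq> D'" for D D'
        using bij_betw_imp_inj_on[OF f] that by (auto dest: inj_onD)
      have C_disj: "C i \<inter> C i' = {}" if "i < length ks" "i' < length ks" "i \<noteq> i'" for i i'
        using C(1) that by (auto simp: disjoint_family_on_def)
      \<comment> \<open>The palettes: \<open>X\<close> splits \<open>C j\<close> between
        \<open>A\<close> and \<open>B\<close>, and \<open>f\<close> distributes the other
        classes.\<close>
      define D where "D = (\<lambda>K. if K = A then C j \<inter> X else if K = B then C j - X else C (f K))"
      have "disjoint_family_on D P"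
        unfolding disjoint_family_on_def
      proof (intro ballI impI)
        fix K K' assume K: "K \<in> P" "K' \<in> P" "K \<noteq> K'"
        have other: "C j \<inter> C (f M) = {}" "C (f M) \<inter> C j = {}" if "M \<in> P" "M \<noteq> A" "M \<noteq> B" for M
          using C_disj[OF j(1) f_less(1)[OF that]] f_less(2)[OF that] by auto
        have both: "C (f K) \<inter> C (f K') = {}" if "K \<notin> {A, B}" "K' \<notin> {A, B}"
          using C_disj[of "f K" "f K'"] f_less f_neq K that by simp
        show "D K \<inter> D K' = {}"
          using K other[of K] other[of K'] both unfolding D_def by auto
      qed
      moreover have "L v \<inter> D K \<noteq> {}" if "K \<in> P" "v \<in> K" for K v
      proof -
        have v: "v \<in> pverts G"
          using G(2) that by (auto simp: multipartition_def partition_on_def)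
        have "L v \<inter> C (f K) \<noteq> {}" if "K \<noteq> A" "K \<noteq> B"
        proof -
          have "card (L v \<inter> C (f K)) > 0"
            using C(2) v pos f_less[OF \<open>K \<in> P\<close> that] by simp
          then show ?thesis by (metis card.empty less_irrefl)
        qed
        then show ?thesis
          using X[of v] that(2) unfolding D_def by auto
      qed
      ultimately have "list_colorable G L"
        unfolding list_colorable_iff_palettes[OF G(2)] by blast
      with ncol show False ..
    qed
  qed
qed

section \<open>From pairs of colors to uncolorable assignments\<close>

text \<open>By disjointness each common color lies in at most one palette. By pigeonhole two parts
  have palettes without common colors, so they are colored from the pairs alone, which yields
  disjoint covers.\<close>

lemma not_list_colorable_common_colors:
  assumes H: "pair_graph H" "multipartition H P"
    and cov: "\<And>A B. A \<in> P \<Longrightarrow> B \<in> P \<Longrightarrow> A \<noteq> B \<Longrightarrow> no_disjoint_covers (S ` A) (S ` B)"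
    and Z: "finite Z" "card Z + 2 \<le> card P"
  shows "\<not> list_colorable H (\<lambda>v. S v \<union> Z)"
proof
  assume "list_colorable H (\<lambda>v. S v \<union> Z)"
  then obtain D where D: "disjoint_family_on D P"
    "\<And>A v. A \<in> P \<Longrightarrow> v \<in> A \<Longrightarrow> (S v \<union> Z) \<inter> D A \<noteq> {}"
    unfolding list_colorable_iff_palettes[OF H(2)] by blast
  define Q where "Q = {A \<in> P. Z \<inter> D A \<noteq> {}}"
  have "\<forall>A\<in>Q. \<exists>z. z \<in> Z \<inter> D A"
    unfolding Q_def by blast
  then obtain g where g: "\<And>A. A \<in> Q \<Longrightarrow> g A \<in> Z \<inter> D A"
    by metis
  have "inj_on g Q"
  proof (rule inj_onI)
    fix A B assume "A \<in> Q" "B \<in> Q" "g A = g B"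
    with g[of A] g[of B] D(1) show "A = B"
      unfolding disjoint_family_on_def Q_def by (metis (no_types, lifting) IntD2 disjoint_iff mem_Collect_eq)
  qed
  then have "card Q \<le> card Z"
    using g Z(1) by (intro card_inj_on_le) auto
  moreover have "card (P - Q) = card P - card Q"
    using multipartition_finite(2)[OF H] by (intro card_Diff_subset) (auto simp: Q_def)
  ultimately have "2 \<le> card (P - Q)"
    using Z(2) by linarith
  then obtain T where "T \<subseteq> P - Q" "card T = 2"
    by (meson obtain_subset_with_card_n)
  then obtain A B where AB: "A \<in> P" "B \<in> P" "A \<noteq> B" "Z \<inter> D A = {}" "Z \<inter> D B = {}"
    unfolding Q_def by (auto simp: card_2_iff)
  \<comment> \<open>The forbidden \<open>X\<close> is the palette of \<open>A\<close>; the palette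
    of \<open>B\<close> is disjoint from it.\<close>
  have "\<forall>e\<in>S ` A. e \<inter> D A \<noteq> {}"
    using D(2)[OF AB(1)] AB(4) by blast
  moreover have "\<forall>f\<in>S ` B. f - D A \<noteq> {}"
  proof -
    have "D A \<inter> D B = {}"
      using D(1) AB(1-3) by (simp add: disjoint_family_on_def)
    then show ?thesis
      using D(2)[OF AB(2)] AB(5) by blast
  qed
  ultimately show False
    using cov[OF AB(1-3)] unfolding no_disjoint_covers_def by blast
qed

text \<open>One assignment serves every \<open>lam\<close> with a part \<open>m\<close> of size at
  least 2: the class of \<open>m\<close> holds all pair colors and \<open>m - 2\<close> common ones,
  and the other classes cut the remaining common colors into consecutive intervals.\<close>

lemma partition_assignment_common_colors:
  fixes S :: "'a \<Rightarrow> nat set"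
  assumes lam: "integer_partition k lam" "m \<in># lam" "2 \<le> m" and ne: "pverts G \<noteq> {}"
    and S: "\<And>v. v \<in> pverts G \<Longrightarrow> card (S v) = 2 \<and> S v \<subseteq> {..<4}"
  shows "partition_assignment G lam (\<lambda>v. S v \<union> {4..<k + 2})"
proof -
  \<comment> \<open>Listing \<open>m\<close> first gives the class with the pairs the index
    0.\<close>
  obtain ms where ms: "lam = mset (m # ms)"
    using lam(2) by (metis ex_mset mset.simps(2) multi_member_split)
  define ks where "ks = m # ms"
  have k: "k = sum_list ks"
    using lam(1) by (simp add: integer_partition_def ms ks_def sum_mset_sum_list)
  define s where "s i = sum_list (take i ks)" for i
  have s_len: "s (length ks) = k"
    by (simp add: s_def k)
  have s_Suc: "s (Suc i) = s i + ks ! i" if "i < length ks" for i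
    using that by (simp add: s_def take_Suc_conv_app_nth)
  have s_mono: "s i \<le> s i'" if "i \<le> i'" for i i'
    using that unfolding s_def by (metis le_add1 le_add_diff_inverse sum_list_append take_add)
  have s1: "s (Suc 0) = m"
    by (simp add: s_def ks_def)
  \<comment> \<open>The offset 2 arises because class 0 takes the \<open>m - 2\<close> common colors
    starting at 4, and so ends just before \<open>m + 2\<close>, which is
    \<open>s 1 + 2\<close>.\<close>
  define C where "C i = (if i = 0 then (\<Union>v\<in>pverts G. S v) \<union> {4..<m + 2} else {s i + 2..<s (Suc i) + 2})"
    for i
  \<comment> \<open>Pair colors are below 4, and \<open>4 \<le> m + 2\<close>, so the bound holds
    for class 0 as well.\<close>
  have C_below: "x < s (Suc i) + 2" if "x \<in> C i" for x i
    using that S s1 \<open>2 \<le> m\<close> unfolding C_def by (fastforce split: if_splits)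
  have C_above: "s i + 2 \<le> x" if "x \<in> C i" "0 < i" for x i
    using that unfolding C_def by simp
  have disj: "C i \<inter> C i' = {}" if "i < i'" for i i'
  proof -
    have "s (Suc i) \<le> s i'"
      using that by (intro s_mono) simp
    then show ?thesis
      using C_below[of _ i] C_above[of _ i'] that by force
  qed
  have "(\<Union>i<length ks. C i) = (\<Union>v\<in>pverts G. S v) \<union> {4..<k + 2}"
  proof -
    \<comment> \<open>The induction starts at \<open>n = 1\<close>, since the pair colors enter with
      class 0.\<close>
    have "(\<Union>i<n. C i) = (\<Union>v\<in>pverts G. S v) \<union> {4..<s n + 2}" if "0 < n" "n \<le> length ks" for n
      using that
    proof (induction n)
      case (Suc n)
      show ?case
      proof (cases "n = 0")
        case True
        then show ?thesis by (simp add: C_def s1 lessThan_Suc)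
      next
        case False
        with Suc have IH: "(\<Union>i<n. C i) = (\<Union>v\<in>pverts G. S v) \<union> {4..<s n + 2}" by simp
        have "2 \<le> s n" "s n \<le> s (Suc n)"
          using s_mono[of "Suc 0" n] s_mono[of n "Suc n"] False s1 \<open>2 \<le> m\<close> by auto
        then have "{4..<s n + 2} \<union> {s n + 2..<s (Suc n) + 2} = {4..<s (Suc n) + 2}"
          by (intro ivl_disj_un) auto
        then show ?thesis
          using IH False by (simp add: lessThan_Suc C_def Un_ac)
      qed
    qed simp
    from this[of "length ks"] show ?thesis
      by (simp add: s_len ks_def[symmetric]) (simp add: ks_def)
  qed
  \<comment> \<open>Without a vertex the common colors would occur in no list.\<close>
  also have "\<dots> = (\<Union>v\<in>pverts G. S v \<union> {4..<k + 2})"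
    using ne by blast
  finally have union: "(\<Union>i<length ks. C i) = (\<Union>v\<in>pverts G. S v \<union> {4..<k + 2})" .
  have "card ((S v \<union> {4..<k + 2}) \<inter> C i) = ks ! i" if v: "v \<in> pverts G" and i: "i < length ks" for v i
  proof (cases "i = 0")
    case True
    have "m \<le> k"
      using k by (simp add: ks_def)
    then have "(S v \<union> {4..<k + 2}) \<inter> C i = S v \<union> {4..<m + 2}"
      using True S v unfolding C_def by fastforce
    moreover have "card (S v \<union> {4..<m + 2}) = card (S v) + card {4..<m + 2}"
      using S[OF v] by (intro card_Un_disjoint) (auto intro: finite_subset)
    ultimately show ?thesis
      using S[OF v] True \<open>2 \<le> m\<close> by (simp add: ks_def)
  next
    case False
    have "2 \<le> s i" "s (Suc i) \<le> k"
      using s_mono[of "Suc 0" i] s_mono[of "Suc i" "length ks"] False i s1 s_len \<open>2 \<le> m\<close> by auto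
    then have "(S v \<union> {4..<k + 2}) \<inter> C i = {s i + 2..<s (Suc i) + 2}"
      using False S[OF v] unfolding C_def by auto
    then show ?thesis
      using s_Suc[OF i] by simp
  qed
  moreover have "k_assignment G k (\<lambda>v. S v \<union> {4..<k + 2})"
    unfolding k_assignment_def
  proof
    fix v assume v: "v \<in> pverts G"
    have fin: "finite (S v)"
      using S[OF v] by (auto intro: finite_subset)
    moreover have "2 \<le> k"
      using k \<open>2 \<le> m\<close> by (simp add: ks_def)
    moreover have "card (S v \<union> {4..<k + 2}) = card (S v) + card {4..<k + 2}"
      using S[OF v] fin by (intro card_Un_disjoint) auto
    ultimately show "finite (S v \<union> {4..<k + 2}) \<and> card (S v \<union> {4..<k + 2}) = k"
      using S[OF v] by simp
  qed
  moreover have "disjoint_family_on C {..<length ks}"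
    unfolding disjoint_family_on_def using disj by (metis Int_commute linorder_neqE_nat)
  ultimately show ?thesis
    using lam(1) union ms unfolding partition_assignment_def integer_partition_def ks_def
    by (intro conjI exI[of _ "m # ms"] exI[of _ C]) auto
qed

lemma integer_partition_large_part:
  assumes "integer_partition k lam" "lam \<noteq> replicate_mset k 1"
  obtains m where "m \<in># lam" "2 \<le> m"
proof -
  have "\<exists>m\<in>#lam. m \<noteq> 1"
  proof (rule ccontr)
    assume "\<not> (\<exists>m\<in>#lam. m \<noteq> 1)"
    then have eq: "lam = replicate_mset (size lam) 1"
      by (intro set_mset_subset_singletonD) auto
    then have "sum_mset lam = size lam"
      by (metis mult.right_neutral of_nat_id sum_mset_replicate_mset)
    with eq assms show False
      by (simp add: integer_partition_def)
  qed
  then obtain m where "m \<in># lam" "m \<noteq> 1" by blast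
  moreover from this assms(1) have "0 < m"
    by (simp add: integer_partition_def)
  ultimately show thesis
    using that by simp
qed

text \<open>Bijections chosen on the single parts are glued together; disjointness of the parts
  makes the part selected by \<open>THE\<close> unique.\<close>

lemma multipartition_edge_labelling:
  fixes E :: "'a set \<Rightarrow> 'c set set"
  assumes H: "pair_graph H" "multipartition H P"
    and E: "\<And>A. A \<in> P \<Longrightarrow> finite (E A) \<and> card (E A) = card A"
  obtains S where "\<And>A. A \<in> P \<Longrightarrow> S ` A = E A"
proof -
  have "\<forall>A\<in>P. \<exists>h. bij_betw h A (E A)"
    using E multipartition_finite(3)[OF H] by (metis finite_same_card_bij)
  then obtain h where h: "\<And>A. A \<in> P \<Longrightarrow> bij_betw (h A) A (E A)"
    by metis
  define S where "S v = h (THE A. A \<in> P \<and> v \<in> A) v" for v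
  have "S v = h A v" if "A \<in> P" "v \<in> A" for A v
  proof -
    have "(THE A. A \<in> P \<and> v \<in> A) = A"
    proof (rule the_equality)
      show "B = A" if "B \<in> P \<and> v \<in> B" for B
        using part_eqI[OF H(2), of B A v] that \<open>A \<in> P\<close> \<open>v \<in> A\<close> by blast
    qed (simp add: that)
    then show ?thesis
      by (simp add: S_def)
  qed
  then have "S ` A = E A" if "A \<in> P" for A
    using h[OF that] that by (simp add: bij_betw_def)
  with that show thesis by blast
qed

text \<open>Distinct parts count with multiplicity even when \<open>f A = f B\<close>, so conditions
  on pairs of parts can be checked on the multiset of sizes.\<close>

lemma pair_in_image_mset_set:
  assumes "finite P" "A \<in> P" "B \<in> P" "A \<noteq> B"
  shows "{#f A, f B#} \<subseteq># image_mset f (mset_set P)"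
proof -
  have "mset_set {A, B} \<subseteq># mset_set P"
    using assms by (intro subset_imp_msubset_mset_set) auto
  then have "image_mset f (mset_set {A, B}) \<subseteq># image_mset f (mset_set P)"
    by (rule image_mset_subseteq_mono)
  with assms(4) show ?thesis
    by simp
qed

section \<open>Strict colorability and the three subgraphs\<close>

text \<open>The witness graphs label the parts of the subgraph, and adding common colors refutes
  choosability for every \<open>lam\<close> with a part at least 2. Stating \<open>cov\<close> with
  submultisets avoids comparing a size that occurs once with itself.\<close>

lemma strictly_colorable_if_contains:
  assumes G: "complete_partite k G"
    and ns: "contains_complete_multipartite G ns" "size ns = k" "ns \<noteq> {#}"
    and sizes: "\<And>n. n \<in># ns \<Longrightarrow> n \<in> {2..6}"
    and cov: "\<And>m n. {#m, n#} \<subseteq># ns \<Longrightarrow> no_disjoint_covers (witness_edges m) (witness_edges n)"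
  shows "strictly_colorable k G"
  unfolding strictly_colorable_def
proof (intro allI impI iffI)
  fix lam assume lam: "integer_partition k lam" and "lam = replicate_mset k 1"
  obtain P where P: "pair_graph G" "multipartition G P" "size (image_mset card (mset_set P)) = k"
    using G unfolding complete_partite_def complete_multipartite_iff by blast
  with \<open>lam = _\<close> show "choosable G lam"
    using choosable_replicate_1[of G P k] by simp
next
  fix lam assume lam: "integer_partition k lam" and ch: "choosable G lam"
  show "lam = replicate_mset k 1"
  proof (rule ccontr)
    assume "lam \<noteq> replicate_mset k 1"
    then obtain m where m: "m \<in># lam" "2 \<le> m"
      using integer_partition_large_part lam by blast
    obtain H P where sub: "subgraph (with_proj H) (with_proj G)"
      and H: "pair_graph H" "multipartition H P" and card: "image_mset card (mset_set P) = ns"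
      using ns(1) unfolding contains_complete_multipartite_def complete_multipartite_iff by blast
    have fin: "finite P"
      by (rule multipartition_finite(2)[OF H])
    have V: "pverts H = \<Union>P"
      using H(2) by (simp add: multipartition_def partition_on_def)
    have P_card: "card P = k"
      using card ns(2) by auto
    have mem: "card A \<in># ns" if "A \<in> P" for A
      using card fin that by auto
    obtain S where S: "\<And>A. A \<in> P \<Longrightarrow> S ` A = witness_edges (card A)"
      using multipartition_edge_labelling[OF H, of "\<lambda>A. witness_edges (card A)"]
        card_witness_edges finite_witness_edges sizes mem by metis
    \<comment> \<open>Vertices outside \<open>H\<close> need lists too; any pair of colors below 4
      will do.\<close>
    define S' where "S' v = (if v \<in> pverts H then S v else {0, 1})" for v
    have S'_P: "S' ` A = witness_edges (card A)" if "A \<in> P" for A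
    proof -
      have "S' ` A = S ` A"
        using that V by (intro image_cong) (auto simp: S'_def)
      with S[OF that] show ?thesis by simp
    qed
    have S': "card (S' v) = 2 \<and> S' v \<subseteq> {..<4}" for v
    proof (cases "v \<in> pverts H")
      case True
      then obtain A where "A \<in> P" "v \<in> A"
        using V by blast
      then have "S' v \<in> witness_edges (card A)"
        using S'_P by blast
      then show ?thesis
        using witness_edges_pairs by blast
    qed (simp add: S'_def)
    have "P \<noteq> {}"
      using ns(3) card by auto
    moreover have "{} \<notin> P"
      using H(2) by (simp add: multipartition_def partition_on_def)
    ultimately have "pverts H \<noteq> {}"
      using V by auto
    then have "pverts G \<noteq> {}"
      using sub by (auto simp: subgraph_def)
    then have "partition_assignment G lam (\<lambda>v. S' v \<union> {4..<k + 2})"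
      using S' by (intro partition_assignment_common_colors[OF lam m]) auto
    with ch have "list_colorable G (\<lambda>v. S' v \<union> {4..<k + 2})"
      by (simp add: choosable_def)
    with sub have "list_colorable H (\<lambda>v. S' v \<union> {4..<k + 2})"
      by (rule list_colorable_subgraph)
    moreover have "\<not> list_colorable H (\<lambda>v. S' v \<union> {4..<k + 2})"
    proof (rule not_list_colorable_common_colors[OF H])
      fix A B assume AB: "A \<in> P" "B \<in> P" "A \<noteq> B"
      then have "{#card A, card B#} \<subseteq># ns"
        unfolding card[symmetric] by (rule pair_in_image_mset_set[OF fin])
      then show "no_disjoint_covers (S' ` A) (S' ` B)"
        unfolding S'_P[OF AB(1)] S'_P[OF AB(2)] by (rule cov)
    next
      \<comment> \<open>This gives \<open>2 \<le> k\<close>, so that the interval has exactly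
        \<open>k - 2\<close> colors and the subtraction is not truncated.\<close>
      have "m \<le> k"
        using lam m(1) by (auto simp: integer_partition_def dest!: multi_member_split)
      then show "card {4..<k + 2} + 2 \<le> card P"
        using m(2) P_card by simp
    qed simp
    ultimately show False by blast
  qed
qed

text \<open>Failure of choosability for the single partition into one 2 and \<open>k - 2\<close>
  ones already supplies the pairs.\<close>

lemma strictly_colorable_imp_contains:
  assumes "2 \<le> k" "complete_partite k G" and strict: "strictly_colorable k G"
  shows "contains_complete_multipartite G (replicate_mset k 3) \<or>
    contains_complete_multipartite G ({#2, 4#} + replicate_mset (k - 2) 6) \<or>
    contains_complete_multipartite G ({#2#} + replicate_mset (k - 1) 5)"
proof -
  obtain P where G: "pair_graph G" "multipartition G P" "size (image_mset card (mset_set P)) = k"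
    using assms(2) unfolding complete_partite_def complete_multipartite_iff by blast
  have fin: "finite P" and k: "card P = k"
    using multipartition_finite(2)[OF G(1,2)] G(3) by auto
  let ?lam = "{#2#} + replicate_mset (k - 2) 1 :: nat multiset"
  have "integer_partition k ?lam"
    using \<open>2 \<le> k\<close> by (auto simp: integer_partition_def)
  moreover have "?lam \<noteq> replicate_mset k 1"
  proof
    assume "?lam = replicate_mset k 1"
    then have "2 \<in># replicate_mset k (1 :: nat)"
      by (metis union_iff multi_member_this)
    then show False by (simp split: if_splits)
  qed
  ultimately have "\<not> choosable G ?lam"
    using strict by (simp add: strictly_colorable_def)
  then obtain S :: "'a \<Rightarrow> nat set" where S: "\<And>v. v \<in> pverts G \<Longrightarrow> card (S v) = 2"
    "\<And>A B. A \<in> P \<Longrightarrow> B \<in> P \<Longrightarrow> A \<noteq> B \<Longrightarrow> no_disjoint_covers (S ` A) (S ` B)"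
    using not_choosable_imp_pairs[OF G(1,2) k _ \<open>2 \<le> k\<close>] by metis
  have finA: "finite A" if "A \<in> P" for A
    using multipartition_finite(3)[OF G(1,2)] that .
  \<comment> \<open>Vertices of a part may carry equal pairs, so the number of distinct pairs only
    bounds the size of the part from below.\<close>
  have le: "n \<le> card A" if "A \<in> P" "n \<le> card (S ` A)" for A n
    using card_image_le[OF finA[OF that(1)], of S] that(2) by linarith
  note contains = contains_complete_multipartiteI[OF G(1,2)]
  have pairs: "\<forall>e\<in>S ` A. card e = 2" if "A \<in> P" for A
    using S(1) G(2) that by (auto simp: multipartition_def partition_on_def)
  show ?thesis
  proof (rule pairwise_no_disjoint_covers_cards[of P "\<lambda>A. S ` A"])
    assume three: "\<And>A. A \<in> P \<Longrightarrow> 3 \<le> card (S ` A)"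
    have "contains_complete_multipartite G (image_mset (\<lambda>_. 3) (mset_set P))"
      using three le by (intro contains) auto
    then show ?thesis
      using k by (simp add: image_mset_const_eq)
  next
    fix A
    assume A: "A \<in> P" "2 \<le> card (S ` A)"
      and five: "\<And>B. B \<in> P \<Longrightarrow> B \<noteq> A \<Longrightarrow> 5 \<le> card (S ` B)"
    let ?f = "\<lambda>B. if B = A then 2 else 5 :: nat"
    have "contains_complete_multipartite G (image_mset ?f (mset_set P))"
      using A five le by (intro contains) auto
    moreover have "image_mset ?f (mset_set (P - {A})) = image_mset (\<lambda>_. 5) (mset_set (P - {A}))"
      using fin by (intro image_mset_cong) auto
    then have "image_mset ?f (mset_set P) = {#2#} + replicate_mset (k - 1) 5"
      using fin A(1) k by (simp add: mset_set.remove[of P A] image_mset_const_eq)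
    ultimately show ?thesis by simp
  next
    fix A B
    assume AB: "A \<in> P" "B \<in> P" "A \<noteq> B" "2 \<le> card (S ` A)" "4 \<le> card (S ` B)"
      and six: "\<And>C. C \<in> P \<Longrightarrow> C \<noteq> A \<Longrightarrow> C \<noteq> B \<Longrightarrow> 6 \<le> card (S ` C)"
    let ?f = "\<lambda>C. if C = A then 2 else if C = B then 4 else 6 :: nat"
    have "contains_complete_multipartite G (image_mset ?f (mset_set P))"
      using AB six le by (intro contains) auto
    moreover have "image_mset ?f (mset_set (P - {A} - {B})) = image_mset (\<lambda>_. 6) (mset_set (P - {A} - {B}))"
      using fin by (intro image_mset_cong) auto
    moreover have "card (P - {A} - {B}) = k - 2"
      using fin AB(1-3) k by simp
    ultimately have "contains_complete_multipartite G ({#2, 4#} + replicate_mset (k - 2) 6)"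
      using fin AB(1-3)
      by (simp add: mset_set.remove[of P A] mset_set.remove[of "P - {A}" B] image_mset_const_eq)
    then show ?thesis by simp
  qed (use k \<open>2 \<le> k\<close> S(2) pairs finA in auto)
qed

lemma pair_subset_replicate_mset:
  assumes "{#m, n#} \<subseteq># replicate_mset r c"
  shows "m = c \<and> n = c"
  using set_mset_mono[OF assms] by (auto split: if_splits)

theorem mainTheorem1:
  fixes G :: "'a pair_pre_digraph" and k :: nat
  assumes "k \<ge> 3" and "complete_partite k G"
  shows "strictly_colorable k G \<longleftrightarrow>
    contains_complete_multipartite G (replicate_mset k 3) \<or>
    contains_complete_multipartite G ({#2, 4#} + replicate_mset (k - 2) 6) \<or>
    contains_complete_multipartite G ({#2#} + replicate_mset (k - 1) 5)"
proof
  assume "strictly_colorable k G"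
  with assms show "contains_complete_multipartite G (replicate_mset k 3) \<or>
    contains_complete_multipartite G ({#2, 4#} + replicate_mset (k - 2) 6) \<or>
    contains_complete_multipartite G ({#2#} + replicate_mset (k - 1) 5)"
    by (intro strictly_colorable_imp_contains) auto
next
  note strict = strictly_colorable_if_contains[OF assms(2)]
  assume "contains_complete_multipartite G (replicate_mset k 3) \<or>
    contains_complete_multipartite G ({#2, 4#} + replicate_mset (k - 2) 6) \<or>
    contains_complete_multipartite G ({#2#} + replicate_mset (k - 1) 5)"
  then show "strictly_colorable k G"
  proof (elim disjE)
    assume "contains_complete_multipartite G (replicate_mset k 3)"
    then show ?thesis
    proof (rule strict)
      fix m n :: nat assume "{#m, n#} \<subseteq># replicate_mset k 3"
      then have "m = 3 \<and> n = 3"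
        by (rule pair_subset_replicate_mset)
      then show "no_disjoint_covers (witness_edges m) (witness_edges n)"
        by (intro no_disjoint_covers_witness_edges) auto
    qed (use assms(1) in \<open>auto split: if_splits\<close>)
  next
    assume "contains_complete_multipartite G ({#2, 4#} + replicate_mset (k - 2) 6)"
    then show ?thesis
    proof (rule strict)
      fix m n :: nat assume sub: "{#m, n#} \<subseteq># {#2, 4#} + replicate_mset (k - 2) 6"
      have "{m, n} \<subseteq> {2, 4, 6}"
        using set_mset_mono[OF sub] by (auto split: if_splits)
      \<comment> \<open>The sizes 2 and 4 each occur once, so two bipartite witness graphs of the
        same size never meet.\<close>
      moreover have "\<not> (m = 2 \<and> n = 2)" "\<not> (m = 4 \<and> n = 4)"
        using mset_subset_eq_count[OF sub, of 2] mset_subset_eq_count[OF sub, of 4] by auto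
      ultimately have "(m, n) \<in> {(2, 4), (2, 6), (4, 6), (6, 6)} \<or> (n, m) \<in> {(2, 4), (2, 6), (4, 6)}"
        by auto
      then show "no_disjoint_covers (witness_edges m) (witness_edges n)"
        using no_disjoint_covers_witness_edges[of m n]
          no_disjoint_covers_sym[OF no_disjoint_covers_witness_edges[of n m]] by auto
    qed (use assms(1) in \<open>auto split: if_splits\<close>)
  next
    assume "contains_complete_multipartite G ({#2#} + replicate_mset (k - 1) 5)"
    then show ?thesis
    proof (rule strict)
      fix m n :: nat assume sub: "{#m, n#} \<subseteq># {#2#} + replicate_mset (k - 1) 5"
      have "{m, n} \<subseteq> {2, 5}"
        using set_mset_mono[OF sub] by (auto split: if_splits)
      moreover have "\<not> (m = 2 \<and> n = 2)"
        using mset_subset_eq_count[OF sub, of 2] by auto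
      \<comment> \<open>Witness pairs are recorded in one order only; symmetry supplies the
        other.\<close>
      ultimately have "(m, n) \<in> {(2, 5), (5, 5)} \<or> (n, m) = (2, 5)"
        by auto
      then show "no_disjoint_covers (witness_edges m) (witness_edges n)"
        using no_disjoint_covers_witness_edges[of m n]
          no_disjoint_covers_sym[OF no_disjoint_covers_witness_edges[of n m]] by auto
    qed (use assms(1) in \<open>auto split: if_splits\<close>)
  qed
qed

end
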